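(* Let $(M,d)$ be a metric space, and let $\mathrm{der}(M)$ denote the set of all limit points of $M$. Then the following are equivalent: (i) $(M,d)$ is universally uniformly continuous, i.e. for every metric space $(M_1,d_1)$, every continuous function $f:M\to M_1$ is uniformly continuous; (ii) $\mathrm{der}(M)$ is compact, and for every $\varepsilon>0$ the set $M\setminus B(\mathrm{der}(M),\varepsilon)$ is uniformly isolated.
   Context: A metric space $(M,d)$ is uniformly continuous with respect to a metric space $(M_1,d_1)$ if every continuous function from $M$ to $M_1$ is uniformly continuous. It is universally uniformly continuous if it is uniformly continuous with respect to every metric space. A subset $E$ of a metric space $(M,d)$ is uniformly isolated if there exists a real number $\eta>0$ such that $d(p,q)\geq\eta$ for all $p\neq q$ in $E$. The derived set $\mathrm{der}(M)$ is the set of all limit points of $(M,d)$, i.e. the points $x\in M$ such that every open ball centered at $x$ contains a point of $M$ other than $x$. For $\varepsilon>0$, $B(\mathrm{der}(M),\varepsilon)=\bigcup_{x\in\mathrm{der}(M)}B(x,\varepsilon)$, where $B(x,\varepsilon)=\{y\in M: d(x,y)<\varepsilon\}$. When $\mathrm{der}(M)=\emptyset$ (which counts as compact), $B(\mathrm{der}(M),\varepsilon)=\emptyset$, so $M\setminus B(\mathrm{der}(M),\varepsilon)=M$. *)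

theory Defs
  imports "HOL-Analysis.Analysis"
begin

definition uniformly_continuous_wrt :: "'a metric \<Rightarrow> 'b metric \<Rightarrow> bool" where
  "uniformly_continuous_wrt m m1 \<longleftrightarrow>
     (\<forall>f. continuous_map (mtopology_of m) (mtopology_of m1) f \<longrightarrow>
          uniformly_continuous_map m m1 f)"

(* HOL cannot quantify over types inside a formula, so the type carrying the target
   spaces is a parameter. The targets are all metric spaces (M1, d1) with M1 any set of
   elements of that type. Every continuous image f(M) of M can be copied, with its metric,
   onto a subset of the type of the points of M, so the instance TYPE('a) already amounts
   to all metric spaces over all types. *)
definition universally_uniformly_continuous :: "'b itself \<Rightarrow> 'a metric \<Rightarrow> bool" where
  "universally_uniformly_continuous _ m \<longleftrightarrow>
     (\<forall>m1 :: 'b metric. uniformly_continuous_wrt m m1)"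

definition uniformly_isolated :: "'a metric \<Rightarrow> 'a set \<Rightarrow> bool" where
  "uniformly_isolated m E \<longleftrightarrow>
     E \<subseteq> mspace m \<and> (\<exists>\<eta>>0. \<forall>p\<in>E. \<forall>q\<in>E. p \<noteq> q \<longrightarrow> mdist m p q \<ge> \<eta>)"

definition der :: "'a metric \<Rightarrow> 'a set" where
  "der m = mtopology_of m derived_set_of mspace m"

lemma der_iff_mball:
  "x \<in> der m \<longleftrightarrow>
     x \<in> mspace m \<and> (\<forall>r>0. \<exists>y\<in>mspace m. y \<noteq> x \<and> y \<in> mball_of m x r)"
  by (simp add: der_def mtopology_of_def mball_of_def Metric_space.metric_derived_set_of)

definition ball_around :: "'a metric \<Rightarrow> 'a set \<Rightarrow> real \<Rightarrow> 'a set" where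
  "ball_around m S \<epsilon> = (\<Union>x\<in>S. mball_of m x \<epsilon>)"

end

theory Submission
  imports Defs
begin

text \<open>
  If every continuous map on \<open>M\<close> is uniformly continuous, then so is every continuous
  \<open>g : M \<rightarrow> \<real>\<close>: the identity from \<open>(M, d)\<close> to \<open>M\<close> with the topologically equivalent metric
  \<open>d x y + \<bar>g x - g y\<bar>\<close> is continuous. By Urysohn's lemma two disjoint closed sets then have
  positive distance. Hence, if \<open>p\<^sub>n \<noteq> q\<^sub>n\<close> and \<open>d p\<^sub>n q\<^sub>n \<rightarrow> 0\<close>, the sequence \<open>p\<close> has a cluster
  point: otherwise a subsequence of \<open>p\<close> and the corresponding one of \<open>q\<close> range over disjoint
  closed sets. Such cluster points yield both the compactness of the derived set and uniform
  isolation away from it. Conversely, a Lebesgue number of the derived set for a cover by sets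
  with small image controls \<open>f\<close> near the derived set, and away from it close points coincide.
\<close>

text \<open>The hypothesis speaks only of targets whose points have type \<open>'a\<close>, so the
  real line is not directly among them; \<open>g\<close> is therefore encoded in a new metric on the
  points of \<open>m\<close>.\<close>

lemma uniformly_continuous_map_real_if_universally:
  fixes m :: "'a metric" and g :: "'a \<Rightarrow> real"
  assumes uuc: "universally_uniformly_continuous TYPE('a) m"
    and g: "continuous_map (mtopology_of m) euclideanreal g"
  shows "uniformly_continuous_map m euclidean_metric g"
proof -
  interpret Metric_space "mspace m" "mdist m" by simp
  define d' where "d' x y = mdist m x y + \<bar>g x - g y\<bar>" for x y
  interpret M': Metric_space "mspace m" d'
  proof
    show "0 \<le> d' x y" for x y by (simp add: d'_def)
    show "d' x y = d' y x" for x y by (simp add: d'_def commute abs_minus_commute)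
    show "(d' x y = 0) = (x = y)" if "x \<in> mspace m" "y \<in> mspace m" for x y
      using that by (auto simp: d'_def add_nonneg_eq_0_iff)
    show "d' x z \<le> d' x y + d' y z"
      if "x \<in> mspace m" "y \<in> mspace m" "z \<in> mspace m" for x y z
      using triangle[OF that] by (simp add: d'_def)
  qed
  have g': "\<exists>\<delta>>0. \<forall>x. x \<in> mspace m \<and> mdist m a x < \<delta> \<longrightarrow> \<bar>g a - g x\<bar> < \<epsilon>"
    if "a \<in> mspace m" "\<epsilon> > 0" for a \<epsilon>
    using g that metric_continuous_map[OF Met_TC.Metric_space_axioms, of g]
    by (auto simp: mtopology_of_def dist_real_def)
  have "continuous_map mtopology M'.mtopology id"
    unfolding metric_continuous_map[OF M'.Metric_space_axioms]
  proof (intro conjI ballI allI impI)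
    fix \<epsilon> :: real assume "\<epsilon> > 0"
    fix a assume a: "a \<in> mspace m"
    obtain \<delta> where "\<delta> > 0" "\<And>x. x \<in> mspace m \<and> mdist m a x < \<delta> \<Longrightarrow> \<bar>g a - g x\<bar> < \<epsilon>/2"
      using g'[OF a, of "\<epsilon>/2"] \<open>\<epsilon> > 0\<close> by auto
    then show "\<exists>\<delta>>0. \<forall>x. x \<in> mspace m \<and> mdist m a x < \<delta> \<longrightarrow> d' (id a) (id x) < \<epsilon>"
      \<comment> \<open>Half of \<epsilon> is spent on the summand \<open>mdist m\<close> of
        \<open>d'\<close>, the other half on the variation of \<open>g\<close>.\<close>
      using \<open>\<epsilon> > 0\<close> by (intro exI[of _ "min \<delta> (\<epsilon>/2)"]) (fastforce simp: d'_def)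
  qed simp
  then have "continuous_map (mtopology_of m) (mtopology_of (metric (mspace m, d'))) id"
    by (simp add: mtopology_of_def)
  then have "uniformly_continuous_map m (metric (mspace m, d')) id"
    using uuc by (simp add: universally_uniformly_continuous_def uniformly_continuous_wrt_def)
  then have "\<exists>\<delta>>0. \<forall>x\<in>mspace m. \<forall>y\<in>mspace m. mdist m y x < \<delta> \<longrightarrow> d' y x < \<epsilon>"
    if "\<epsilon> > 0" for \<epsilon>
    using that by (simp add: uniformly_continuous_map_def)
  moreover have "\<bar>g y - g x\<bar> \<le> d' y x" for x y by (simp add: d'_def)
  ultimately show ?thesis
    by (simp add: uniformly_continuous_map_def dist_real_def) (meson le_less_trans)
qed

lemma disjoint_closed_sets_apart:
  fixes m :: "'a metric"
  assumes uuc: "universally_uniformly_continuous TYPE('a) m"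
    and "closedin (mtopology_of m) A" "closedin (mtopology_of m) B" "disjnt A B"
  obtains \<delta> where "\<delta> > 0" "\<And>a b. a \<in> A \<Longrightarrow> b \<in> B \<Longrightarrow> mdist m a b \<ge> \<delta>"
proof -
  interpret Metric_space "mspace m" "mdist m" by simp
  have AB: "A \<subseteq> mspace m" "B \<subseteq> mspace m"
    using assms(2,3) closedin_subset by (auto simp flip: topspace_mtopology_of)
  have "normal_space (mtopology_of m)"
    using normal_space_mtopology by (simp add: mtopology_of_def)
  then obtain g where g: "continuous_map (mtopology_of m) euclideanreal g"
      "g ` A \<subseteq> {0}" "g ` B \<subseteq> {1}"
    using Urysohn_lemma_alt assms(2-4) by metis
  then have "uniformly_continuous_map m euclidean_metric g"
    using uniformly_continuous_map_real_if_universally[OF uuc] by blast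
  then obtain \<delta> where "\<delta> > 0"
    and \<delta>: "\<And>x y. x \<in> mspace m \<Longrightarrow> y \<in> mspace m \<Longrightarrow> mdist m y x < \<delta> \<Longrightarrow> dist (g y) (g x) < 1"
    unfolding uniformly_continuous_map_def by (metis mdist_euclidean_metric zero_less_one)
  have "mdist m a b \<ge> \<delta>" if "a \<in> A" "b \<in> B" for a b
    using \<delta>[of b a] that AB g by (force simp: dist_real_def)
  with \<open>\<delta> > 0\<close> show ?thesis using that by blast
qed

text \<open>Finitely many indices give finitely many values in some ball around each point, so the
  image has no limit points and is closed. Counting indices lets one hypothesis on \<open>x\<close>
  serve every subsequence \<open>N\<close>.\<close>

lemma (in Metric_space) closedin_image_if_no_cluster_point:
  fixes x :: "nat \<Rightarrow> 'a"
  assumes x: "range x \<subseteq> M"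
    and nocl: "\<And>z. z \<in> M \<Longrightarrow> \<exists>e>0. finite {n. d z (x n) < e}"
  shows "closedin mtopology (x ` N)"
proof -
  have "mtopology derived_set_of (x ` N) = {}"
  proof -
    have "\<exists>e>0. finite (x ` N \<inter> mball z e)" if "z \<in> M" for z
    proof -
      obtain e where "e > 0" and fin: "finite {n. d z (x n) < e}"
        using nocl \<open>z \<in> M\<close> by blast
      have "x ` N \<inter> mball z e \<subseteq> x ` {n. d z (x n) < e}" by auto
      then show ?thesis using \<open>e > 0\<close> fin finite_surj by blast
    qed
    then show ?thesis unfolding derived_set_of_infinite_mball by blast
  qed
  then show ?thesis using x by (auto simp: closedin_contains_derived_set)
qed

text \<open>The conclusion counts indices, not values, because \<open>p\<close> may repeat values.
  Users recover distinct points from injectivity of \<open>p\<close> or from the partners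
  \<open>q n\<close>.\<close>

lemma cluster_point_of_close_pairs:
  fixes m :: "'a metric" and p q :: "nat \<Rightarrow> 'a"
  assumes uuc: "universally_uniformly_continuous TYPE('a) m"
    and p: "range p \<subseteq> mspace m" and q: "range q \<subseteq> mspace m"
    and neq: "\<And>n. p n \<noteq> q n"
    and lim: "(\<lambda>n. mdist m (p n) (q n)) \<longlonglongrightarrow> 0"
  obtains z where "z \<in> mspace m" "\<And>e. e > 0 \<Longrightarrow> infinite {n. mdist m z (p n) < e}"
proof (rule ccontr)
  interpret Metric_space "mspace m" "mdist m" by simp
  assume "\<not> thesis"
  then have "\<forall>z\<in>mspace m. \<exists>e>0. finite {n. mdist m z (p n) < e}"
    using that by blast
  note nop = bspec[OF this]
  \<comment> \<open>A cluster point of \<open>q\<close> would also be one of \<open>p\<close>, as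
    partners get arbitrarily close.\<close>
  have noq: "\<exists>e>0. finite {n. mdist m z (q n) < e}" if z: "z \<in> mspace m" for z
  proof -
    obtain e where "e > 0" and fin: "finite {n. mdist m z (p n) < e}"
      using nop[OF z] by blast
    obtain N where N: "\<And>n. n \<ge> N \<Longrightarrow> mdist m (p n) (q n) < e/2"
      using \<open>e > 0\<close> order_tendstoD(2)[OF lim, of "e/2"]
      by (auto simp: eventually_sequentially)
    have "{n. mdist m z (q n) < e/2} \<subseteq> {..<N} \<union> {n. mdist m z (p n) < e}"
    proof (intro subsetI)
      fix n assume "n \<in> {n. mdist m z (q n) < e/2}"
      moreover have "mdist m z (p n) \<le> mdist m z (q n) + mdist m (p n) (q n)"
        using triangle[of z "q n" "p n"] z p q
        by (simp add: commute image_subset_iff)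
      ultimately show "n \<in> {..<N} \<union> {n. mdist m z (p n) < e}"
        using N[of n] by (cases "n < N") auto
    qed
    with fin \<open>e > 0\<close> show ?thesis
      by (intro exI[of _ "e/2"]) (auto intro: finite_subset)
  qed
  have finp: "finite {n. p n = z}" if "z \<in> mspace m" for z
    using nop[OF that] that by (force elim: rev_finite_subset)
  have finq: "finite {n. q n = z}" if "z \<in> mspace m" for z
    using noq[OF that] that by (force elim: rev_finite_subset)
  \<comment> \<open>Each value is taken only finitely often, so from some index on neither sequence
    meets the finitely many points of the other up to index \<open>k\<close>.\<close>
  have "\<exists>l>k. \<forall>n\<ge>l. \<forall>i\<le>k. p n \<noteq> q i \<and> q n \<noteq> p i" for k
  proof -
    have "finite (\<Union>i\<le>k. {n. p n = q i} \<union> {n. q n = p i})"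
      using finp finq p q by (intro finite_UN_I) (auto simp: range_subsetD)
    then obtain b where b: "\<forall>n\<in>(\<Union>i\<le>k. {n. p n = q i} \<union> {n. q n = p i}). n < b"
      by (auto simp only: finite_nat_set_iff_bounded)
    have "p n \<noteq> q i \<and> q n \<noteq> p i" if "n \<ge> max b (Suc k)" "i \<le> k" for n i
      using b[rule_format, of n] that by force
    then show ?thesis
      by (intro exI[of _ "max b (Suc k)"]) simp
  qed
  then obtain h where h: "\<And>k. h k > k"
    "\<And>k n i. n \<ge> h k \<Longrightarrow> i \<le> k \<Longrightarrow> p n \<noteq> q i \<and> q n \<noteq> p i" by metis
  define r where "r = rec_nat 0 (\<lambda>_. h)"
  have r_Suc: "r (Suc k) = h (r k)" for k by (simp add: r_def)
  have mono: "strict_mono r"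
    by (simp add: strict_mono_Suc_iff r_Suc h(1))
  \<comment> \<open>Here \<open>r j\<close> is at least \<open>r (Suc i) = h (r i)\<close>, which is
    the bound that \<open>h\<close> guarantees for \<open>k = r i\<close>.\<close>
  have far: "p (r j) \<noteq> q (r i) \<and> q (r j) \<noteq> p (r i)" if "i < j" for i j
    using h(2)[of "r i" "r j" "r i"] that mono
    by (metis Suc_leI order_refl r_Suc strict_mono_less_eq)
  have disj: "disjnt (p ` range r) (q ` range r)"
  proof -
    \<comment> \<open>Distinct indices are covered by \<open>far\<close> in one order or the other,
      equal ones by \<open>neq\<close>.\<close>
    have "p (r i) \<noteq> q (r j)" for i j
      using far[of i j] far[of j i] neq by (metis nat_neq_iff)
    then show ?thesis by (auto simp: disjnt_iff)
  qed
  have "closedin (mtopology_of m) (p ` range r)" "closedin (mtopology_of m) (q ` range r)"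
    using closedin_image_if_no_cluster_point p q nop noq by (auto simp: mtopology_of_def)
  then obtain \<delta> where "\<delta> > 0" and \<delta>: "\<And>k. mdist m (p (r k)) (q (r k)) \<ge> \<delta>"
    using disjoint_closed_sets_apart[OF uuc _ _ disj] by (metis rangeI imageI)
  have "(\<lambda>k. mdist m (p (r k)) (q (r k))) \<longlonglongrightarrow> 0"
    using LIMSEQ_subseq_LIMSEQ[OF lim mono] by (simp add: o_def)
  then have "\<delta> \<le> 0"
    by (rule LIMSEQ_le_const) (use \<delta> in blast)
  with \<open>\<delta> > 0\<close> show False by simp
qed

text \<open>By Bolzano-Weierstrass it suffices to find a limit point of each infinite
  \<open>T\<close> inside \<open>der m\<close>. An injective sequence in \<open>T\<close> consists
  of limit points, so each term has a partner as close as desired, and the sequence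
  clusters.\<close>

lemma compactin_der_if_universally:
  fixes m :: "'a metric"
  assumes uuc: "universally_uniformly_continuous TYPE('a) m"
  shows "compactin (mtopology_of m) (der m)"
proof -
  interpret Metric_space "mspace m" "mdist m" by simp
  have sub: "der m \<subseteq> mspace m" by (auto simp: der_iff_mball)
  have "der m \<inter> mtopology derived_set_of T \<noteq> {}" if T: "T \<subseteq> der m" "infinite T" for T
  proof -
    obtain p :: "nat \<Rightarrow> 'a" where p: "inj p" "range p \<subseteq> T"
      using infinite_countable_subset[OF T(2)] by blast
    have "\<exists>y\<in>mspace m. y \<noteq> p n \<and> mdist m (p n) y < inverse (Suc n)" for n
    proof -
      have "p n \<in> der m" using p T by auto
      then show ?thesis unfolding der_iff_mball
        by (metis in_mball_of inverse_positive_iff_positive of_nat_0_less_iff zero_less_Suc)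
    qed
    then obtain q where q: "\<And>n. q n \<in> mspace m" "\<And>n. p n \<noteq> q n"
      "\<And>n. mdist m (p n) (q n) < inverse (Suc n)" by metis
    have "(\<lambda>n. mdist m (p n) (q n)) \<longlonglongrightarrow> 0"
      by (rule Lim_null_comparison[OF _ LIMSEQ_inverse_real_of_nat])
        (use q in \<open>auto intro!: always_eventually less_imp_le\<close>)
    then obtain z where z: "z \<in> mspace m" "\<And>e. e > 0 \<Longrightarrow> infinite {n. mdist m z (p n) < e}"
      using cluster_point_of_close_pairs[OF uuc, of p q] p q T sub by blast
    have "infinite (T \<inter> mball z e)" if "e > 0" for e
    proof -
      have pM: "p n \<in> mspace m" for n using p(2) T(1) sub by blast
      \<comment> \<open>Injectivity turns infinitely many indices into infinitely many points of
        \<open>T\<close>.\<close>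
      have "infinite (p ` {n. mdist m z (p n) < e})"
        using z(2)[OF that] p(1) by (meson finite_imageD inj_on_subset subset_UNIV)
      moreover have "p ` {n. mdist m z (p n) < e} \<subseteq> T \<inter> mball z e"
        using p(2) pM z(1) by auto
      ultimately show ?thesis using finite_subset by blast
    qed
    with z(1) have "z \<in> mtopology derived_set_of T"
      by (simp add: derived_set_of_infinite_mball)
    moreover from this have "z \<in> der m"
      using derived_set_of_mono[of T "mspace m" mtopology] T sub
      by (auto simp: der_def mtopology_of_def)
    ultimately show ?thesis by blast
  qed
  then show ?thesis
    using sub by (simp add: mtopology_of_def compactin_eq_Bolzano_Weierstrass)
qed

text \<open>Failure gives ever closer pairs outside the neighbourhood of \<open>der m\<close>. Their
  cluster point is itself in \<open>der m\<close>, yet some \<open>p n\<close> lies within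
  \<epsilon> of it.\<close>

lemma uniformly_isolated_if_universally:
  fixes m :: "'a metric"
  assumes uuc: "universally_uniformly_continuous TYPE('a) m" and "\<epsilon> > 0"
  shows "uniformly_isolated m (mspace m - ball_around m (der m) \<epsilon>)" (is "uniformly_isolated m ?E")
proof (rule ccontr)
  interpret Metric_space "mspace m" "mdist m" by simp
  assume "\<not> uniformly_isolated m ?E"
  then have "\<exists>p\<in>?E. \<exists>q\<in>?E. p \<noteq> q \<and> mdist m p q < inverse (Suc n)" for n
    unfolding uniformly_isolated_def
    by (metis Diff_subset inverse_positive_iff_positive linorder_not_less of_nat_0_less_iff zero_less_Suc)
  then obtain p q where pq: "\<And>n. p n \<in> ?E" "\<And>n. q n \<in> ?E" "\<And>n. p n \<noteq> q n"
    "\<And>n. mdist m (p n) (q n) < inverse (Suc n)" by metis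
  have lim: "(\<lambda>n. mdist m (p n) (q n)) \<longlonglongrightarrow> 0"
    by (rule Lim_null_comparison[OF _ LIMSEQ_inverse_real_of_nat])
      (use pq in \<open>auto intro!: always_eventually less_imp_le\<close>)
  then obtain z where z: "z \<in> mspace m" "\<And>e. e > 0 \<Longrightarrow> infinite {n. mdist m z (p n) < e}"
    using cluster_point_of_close_pairs[OF uuc, of p q] pq by blast
  have "\<exists>y\<in>mspace m. y \<noteq> z \<and> y \<in> mball_of m z e" if "e > 0" for e
  proof -
    obtain N where N: "\<And>n. n \<ge> N \<Longrightarrow> mdist m (p n) (q n) < e/2"
      using \<open>e > 0\<close> order_tendstoD(2)[OF lim, of "e/2"]
      by (auto simp: eventually_sequentially)
    obtain n where n: "n \<ge> N" "mdist m z (p n) < e/2"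
      using z(2)[of "e/2"] \<open>e > 0\<close> by (auto simp: infinite_nat_iff_unbounded_le)
    have "mdist m z (q n) < e"
      using triangle[of z "p n" "q n"] z(1) pq(1,2)[of n] n N[of n] by auto
    \<comment> \<open>Both \<open>p n\<close> and \<open>q n\<close> are within \<open>e\<close> of
      \<open>z\<close>, and being distinct they cannot both equal \<open>z\<close>.\<close>
    then show ?thesis
      using pq(1-3)[of n] z(1) n(2) \<open>e > 0\<close> by (cases "p n = z") force+
  qed
  then have "z \<in> der m" using z(1) by (simp add: der_iff_mball)
  moreover obtain n where "mdist m z (p n) < \<epsilon>"
    using z(2)[OF \<open>\<epsilon> > 0\<close>] not_finite_existsD by blast
  ultimately have "p n \<in> ball_around m (der m) \<epsilon>"
    using z(1) pq(1)[of n] by (auto simp: ball_around_def)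
  with pq(1)[of n] show False by blast
qed

lemma universally_if_compact_der:
  fixes m :: "'a metric"
  assumes comp: "compactin (mtopology_of m) (der m)"
    and iso: "\<And>\<epsilon>. \<epsilon> > 0 \<Longrightarrow> uniformly_isolated m (mspace m - ball_around m (der m) \<epsilon>)"
  shows "universally_uniformly_continuous TYPE('b) m"
  unfolding universally_uniformly_continuous_def uniformly_continuous_wrt_def
proof (intro allI impI)
  fix m1 :: "'b metric" and f
  assume f: "continuous_map (mtopology_of m) (mtopology_of m1) f"
  interpret Metric_space "mspace m" "mdist m" by simp
  interpret M1: Metric_space "mspace m1" "mdist m1" by simp
  have fim: "f \<in> mspace m \<rightarrow> mspace m1"
    using f by (auto simp: continuous_map_def)
  have sub: "der m \<subseteq> mspace m" by (auto simp: der_iff_mball)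
  show "uniformly_continuous_map m m1 f"
    unfolding uniformly_continuous_map_def
  proof (intro conjI allI impI fim)
    fix \<epsilon> :: real assume "\<epsilon> > 0"
    \<comment> \<open>The radius \<epsilon>/2 keeps the images of any two points of one
      \<open>U c\<close> less than \<epsilon> apart.\<close>
    define U where "U x = {y \<in> mspace m. f y \<in> M1.mball (f x) (\<epsilon>/2)}" for x
    have "openin mtopology (U x)" for x
      unfolding U_def
      using openin_continuous_map_preimage[OF f, of "M1.mball (f x) (\<epsilon>/2)"]
      by (simp add: mtopology_of_def)
    moreover have "der m \<subseteq> \<Union>(range U)"
      using sub fim \<open>\<epsilon> > 0\<close> by (force simp: U_def)
    ultimately obtain l where "l > 0" and l: "\<And>x. x \<in> der m \<Longrightarrow> \<exists>c. mball x l \<subseteq> U c"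
      using lebesgue_number[of "der m" "range U"] comp by (force simp: mtopology_of_def)
    \<comment> \<open>Isolation is used at \<open>l/2\<close>, half the Lebesgue number: if
      \<open>p\<close> is within \<open>l/2\<close> of a limit point and \<open>q\<close> within
      \<open>l/2\<close> of \<open>p\<close>, both lie in one ball of radius \<open>l\<close>, hence
      in one \<open>U c\<close>.\<close>
    obtain \<eta> where "\<eta> > 0" and \<eta>: "\<And>p q. p \<in> mspace m - ball_around m (der m) (l/2) \<Longrightarrow>
        q \<in> mspace m - ball_around m (der m) (l/2) \<Longrightarrow> p \<noteq> q \<Longrightarrow> mdist m p q \<ge> \<eta>"
      using iso[of "l/2"] \<open>l > 0\<close> by (auto simp: uniformly_isolated_def)
    have near: "mdist m1 (f p) (f q) < \<epsilon>"
      if p: "p \<in> ball_around m (der m) (l/2)" and "q \<in> mspace m" "mdist m p q < l/2" for p q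
    proof -
      obtain x where x: "x \<in> der m" "p \<in> mspace m" "mdist m x p < l/2"
        using p by (auto simp: ball_around_def)
      then have "mdist m x q < l"
        using triangle[of x p q] that sub by auto
      with x \<open>l > 0\<close> that sub have "p \<in> mball x l" "q \<in> mball x l" by auto
      then obtain c where "p \<in> U c" "q \<in> U c" using l[OF x(1)] by blast
      then show ?thesis
        using M1.triangle[of "f p" "f c" "f q"] by (auto simp: U_def M1.commute)
    qed
    have "mdist m1 (f y) (f x) < \<epsilon>"
      if xy: "x \<in> mspace m" "y \<in> mspace m" "mdist m y x < min \<eta> (l/2)" for x y
    proof -
      \<comment> \<open>If neither point is within \<open>l/2\<close> of \<open>der m\<close>, both
        lie in the uniformly isolated set, where distance below \<eta> forces equality.\<close>
      consider "x = y" | "y \<in> ball_around m (der m) (l/2)" | "x \<in> ball_around m (der m) (l/2)"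
        using \<eta>[of y x] xy by fastforce
      then show ?thesis
      proof cases
        case 1
        then show ?thesis using \<open>\<epsilon> > 0\<close> xy fim by (auto simp: Pi_iff)
      next
        case 2
        then show ?thesis using near xy by simp
      next
        case 3
        then show ?thesis using near[of x y] xy by (simp add: commute M1.commute)
      qed
    qed
    then show "\<exists>\<delta>>0. \<forall>x\<in>mspace m. \<forall>y\<in>mspace m. mdist m y x < \<delta> \<longrightarrow> mdist m1 (f y) (f x) < \<epsilon>"
      using \<open>\<eta> > 0\<close> \<open>l > 0\<close> by (intro exI[of _ "min \<eta> (l/2)"]) auto
  qed
qed

text \<open>The second conjunct extends the implication from the conditions on \<open>der m\<close>
  to targets over an arbitrary type \<open>'b\<close>; together with the first, universality for
  \<open>TYPE('a)\<close> yields it for every type.\<close>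

theorem corollary1:
  fixes m :: "'a metric"
  shows "(universally_uniformly_continuous TYPE('a) m \<longleftrightarrow>
            compactin (mtopology_of m) (der m) \<and>
            (\<forall>\<epsilon>>0. uniformly_isolated m (mspace m - ball_around m (der m) \<epsilon>)))
       \<and> (compactin (mtopology_of m) (der m) \<and>
            (\<forall>\<epsilon>>0. uniformly_isolated m (mspace m - ball_around m (der m) \<epsilon>))
          \<longrightarrow> universally_uniformly_continuous TYPE('b) m)"
proof (intro conjI iffI impI allI)
  assume uuc: "universally_uniformly_continuous TYPE('a) m"
  show "compactin (mtopology_of m) (der m)"
    by (rule compactin_der_if_universally[OF uuc])
  show "uniformly_isolated m (mspace m - ball_around m (der m) \<epsilon>)" if "\<epsilon> > 0" for \<epsilon>
    by (rule uniformly_isolated_if_universally[OF uuc that])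
qed (erule conjE, rule universally_if_compact_der, simp_all)+

end
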